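(* Consider the multi-period VaR-constrained portfolio problem of minimizing $f(x)$ over $x\in\Omega$, where $f$ and $\Omega$ are as defined in the context, and set $v^*:=\inf_{x\in\Omega}f(x)$, $S^*:=\operatorname*{arg\,min}_{x\in\Omega}f(x)$. Assume that $\Omega\neq\varnothing$. Then the problem admits a global minimizer, its optimal value $v^*$ is finite, and the global solution set $S^*$ is nonempty and compact.
   Context: Model. Let $n,T\in\mathbb N=\{1,2,\dots\}$. Let $X:=\{z\in\mathbb R^n:\sum_{i=1}^n z_i=1,\ z_i\ge 0,\ i=1,\dots,n\}$ and $\mathcal X:=X^T\subset(\mathbb R^n)^T\cong\mathbb R^{nT}$; elements are written $x=(x^1,\dots,x^T)$ with blocks $x^t\in\mathbb R^n$, and $\|\cdot\|$ is the Euclidean norm. Fix $w_{\mathrm{prev}}\in X$. For each $t=1,\dots,T$ let $S_t\in\mathbb N$ and let $\xi^t$ be a discrete random vector taking values $\xi^t_j\in\mathbb R^n$ with probabilities $p^t_j>0$, $j=1,\dots,S_t$, $\sum_{j=1}^{S_t}p^t_j=1$; put $\mu^t:=\sum_{j=1}^{S_t}p_j^t\xi_j^t$. Fix $\alpha\in(0,1)$, $\lambda_1>0$, $\lambda_2>0$, $c_i\ge 0$ ($i=1,\dots,n$), and $\tau\in\mathbb R$. For a real random variable $L$, $\operatorname{VaR}_\alpha(L):=\inf\{u\in\mathbb R:\mathbb P(L\le u)\ge\alpha\}$. Objective: $f(x):=-\sum_{t=1}^T(\mu^t)^\top x^t+\lambda_1\Big[\sum_{i=1}^n c_i|x_i^1-(w_{\mathrm{prev}})_i|+\sum_{t=2}^T\sum_{i=1}^n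 c_i|x_i^t-x_i^{t-1}|\Big]+\lambda_2\sum_{t=1}^T\|x^t\|^2$. Feasible set: $\Omega:=\{x\in\mathcal X:\operatorname{VaR}_\alpha(-(\xi^t)^\top x^t)\le\tau,\ t=1,\dots,T\}$. *)

theory Defs
  imports "HOL-Probability.Probability"
begin

definition unit_simplex :: "(real ^ 'n) set" where
  "unit_simplex = {z. (\<Sum>i\<in>UNIV. z $ i) = 1 \<and> (\<forall>i. 0 \<le> z $ i)}"

text \<open>The space of \<open>T\<close>-tuples of vectors of \<open>\<real>\<^sup>n\<close> is modelled by the functions on \<open>nat\<close> that
  are extensional on \<open>{1..T}\<close>, with block \<open>x t\<close> for period \<open>t\<close>; its Euclidean topology is the
  finite product topology.\<close>

definition block_topology :: "nat \<Rightarrow> (nat \<Rightarrow> real ^ 'n) topology" where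
  "block_topology T = product_topology (\<lambda>_. euclidean) {1..T}"

definition portfolio_paths :: "nat \<Rightarrow> (nat \<Rightarrow> real ^ 'n) set" where
  "portfolio_paths T = (\<Pi>\<^sub>E t\<in>{1..T}. unit_simplex)"

text \<open>The vector \<open>Y\<close> takes the values \<open>v 1, \<dots>, v m\<close> with probabilities \<open>p 1, \<dots>, p m\<close>. The values
  need not be distinct: coinciding scenarios pool their probabilities. If they are distinct, the
  last clause says that \<open>Y = v j\<close> has probability \<open>p j\<close>.\<close>

definition discrete_random_vector ::
  "'a measure \<Rightarrow> ('a \<Rightarrow> real ^ 'n) \<Rightarrow> nat \<Rightarrow> (nat \<Rightarrow> real ^ 'n) \<Rightarrow> (nat \<Rightarrow> real) \<Rightarrow> bool" where
  "discrete_random_vector M Y m v p \<longleftrightarrow>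
     Y \<in> borel_measurable M \<and>
     (\<forall>j\<in>{1..m}. 0 < p j) \<and> (\<Sum>j=1..m. p j) = 1 \<and>
     (\<forall>y. measure M {\<omega> \<in> space M. Y \<omega> = y} = (\<Sum>j | j \<in> {1..m} \<and> v j = y. p j))"

text \<open>For \<open>0 < \<alpha> < 1\<close> and a real random variable \<open>L\<close> on a probability space, the set below is
  nonempty and bounded below, so the real infimum is the proper one.\<close>

definition VaR :: "'a measure \<Rightarrow> real \<Rightarrow> ('a \<Rightarrow> real) \<Rightarrow> real" where
  "VaR M \<alpha> L = Inf {u. measure M {\<omega> \<in> space M. L \<omega> \<le> u} \<ge> \<alpha>}"

definition scenario_mean :: "nat \<Rightarrow> (nat \<Rightarrow> real ^ 'n) \<Rightarrow> (nat \<Rightarrow> real) \<Rightarrow> real ^ 'n" where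
  "scenario_mean m v p = (\<Sum>j=1..m. p j *\<^sub>R v j)"

definition objective ::
  "nat \<Rightarrow> (nat \<Rightarrow> real ^ 'n) \<Rightarrow> real \<Rightarrow> real \<Rightarrow> ('n \<Rightarrow> real) \<Rightarrow> real ^ 'n
    \<Rightarrow> (nat \<Rightarrow> real ^ 'n) \<Rightarrow> real" where
  "objective T \<mu> lam1 lam2 c w_prev x =
     - (\<Sum>t=1..T. \<mu> t \<bullet> x t)
     + lam1 * ((\<Sum>i\<in>UNIV. c i * \<bar>x 1 $ i - w_prev $ i\<bar>)
             + (\<Sum>t=2..T. \<Sum>i\<in>UNIV. c i * \<bar>x t $ i - x (t - 1) $ i\<bar>))
     + lam2 * (\<Sum>t=1..T. (norm (x t))\<^sup>2)"

definition feasible_set ::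
  "'a measure \<Rightarrow> (nat \<Rightarrow> 'a \<Rightarrow> real ^ 'n) \<Rightarrow> nat \<Rightarrow> real \<Rightarrow> real \<Rightarrow> (nat \<Rightarrow> real ^ 'n) set" where
  "feasible_set M \<xi> T \<alpha> \<tau> =
     {x \<in> portfolio_paths T. \<forall>t\<in>{1..T}. VaR M \<alpha> (\<lambda>\<omega>. - (\<xi> t \<omega> \<bullet> x t)) \<le> \<tau>}"

text \<open>Extended-real valued, so that finiteness of the optimal value is a genuine claim.\<close>

definition optimal_value :: "('b \<Rightarrow> real) \<Rightarrow> 'b set \<Rightarrow> ereal" where
  "optimal_value f \<Omega> = (INF x\<in>\<Omega>. ereal (f x))"

definition solution_set :: "('b \<Rightarrow> real) \<Rightarrow> 'b set \<Rightarrow> 'b set" where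
  "solution_set f \<Omega> = {x. is_arg_min f (\<lambda>y. y \<in> \<Omega>) x}"

end

theory Submission imports Defs begin

text \<open>The constraint \<open>VaR\<^sub>\<alpha>(L) \<le> \<tau>\<close> amounts to \<open>P(L \<le> \<tau>) \<ge> \<alpha>\<close>, because distribution functions
  are right continuous. For losses that depend continuously on the decision this condition is
  closed: if \<open>L\<^sub>k \<longlonglongrightarrow> L\<close> pointwise, then the limes superior of the events \<open>L\<^sub>k \<le> \<tau>\<close> is contained in
  the event \<open>L \<le> \<tau>\<close>. Hence the feasible set is a finite product of compact subsets of the simplex,
  and the continuous objective attains its minimum on it.\<close>

lemma compact_unit_simplex: "compact (unit_simplex :: (real ^ 'n) set)"
proof -
  have "closed (unit_simplex :: (real ^ 'n) set)"
    unfolding unit_simplex_def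
    by (intro closed_Collect_conj closed_Collect_all closed_Collect_eq closed_Collect_le
        continuous_intros)
  \<comment> \<open>On the simplex the l1 norm equals the sum of the coordinates, which is 1, and it
    dominates the Euclidean norm.\<close>
  moreover have "norm z \<le> 1" if "z \<in> unit_simplex" for z :: "real ^ 'n"
    using norm_le_l1_cart[of z] that by (simp add: unit_simplex_def)
  then have "bounded (unit_simplex :: (real ^ 'n) set)"
    by (auto simp: bounded_iff)
  ultimately show ?thesis
    by (simp add: compact_eq_bounded_closed)
qed

text \<open>The levels \<open>u\<close> with \<open>F u \<ge> \<alpha>\<close> form an upward closed
  set, and right continuity of the distribution function \<open>F\<close> puts their infimum into
  the set.\<close>

lemma VaR_le_iff:
  assumes "prob_space M" and L: "L \<in> borel_measurable M" and "0 < \<alpha>" and "\<alpha> < 1"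
  shows "VaR M \<alpha> L \<le> \<tau> \<longleftrightarrow> \<alpha> \<le> measure M {\<omega> \<in> space M. L \<omega> \<le> \<tau>}"
proof -
  interpret prob_space M by fact
  interpret D: real_distribution "distr M borel L"
    using L by (rule real_distribution_distr)
  define F where "F = cdf (distr M borel L)"
  have F: "measure M {\<omega> \<in> space M. L \<omega> \<le> u} = F u" for u
    using L unfolding F_def cdf_def
    by (subst measure_distr) (auto intro!: arg_cong[where f = "measure M"])
  let ?A = "{u. \<alpha> \<le> F u}"
  have mono: "F u \<le> F v" if "u \<le> v" for u v
    using that unfolding F_def by (rule D.cdf_nondecreasing)
  \<comment> \<open>A real \<open>Inf\<close> is meaningful only for a nonempty set that is bounded
    below. The limits of \<open>F\<close> at the two ends give these properties, from
    \<open>\<alpha> < 1\<close> and \<open>0 < \<alpha>\<close> respectively.\<close>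
  have "(F \<longlongrightarrow> 1) at_top"
    unfolding F_def by (rule D.cdf_lim_at_top_prob)
  from order_tendstoD(1)[OF this \<open>\<alpha> < 1\<close>] obtain u where "\<alpha> < F u"
    by (auto simp: eventually_at_top_linorder)
  then have ne: "?A \<noteq> {}"
    using less_imp_le by blast
  have "(F \<longlongrightarrow> 0) at_bot"
    unfolding F_def by (rule D.cdf_lim_at_bot)
  from order_tendstoD(2)[OF this \<open>0 < \<alpha>\<close>] obtain l where "F l < \<alpha>"
    by (auto simp: eventually_at_bot_linorder)
  then have bdd: "bdd_below ?A"
    using mono by (intro bdd_belowI[of _ l]) (metis linorder_le_cases mem_Collect_eq not_le order_trans)
  have "Inf ?A \<le> \<tau> \<longleftrightarrow> \<alpha> \<le> F \<tau>"
  proof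
    assume "\<alpha> \<le> F \<tau>"
    then show "Inf ?A \<le> \<tau>"
      using bdd by (intro cInf_lower) auto
  next
    assume le: "Inf ?A \<le> \<tau>"
    \<comment> \<open>The infimum is not yet known to be attained, so the bound is shown strictly
      above \<open>\<tau>\<close> first and then passed to the limit from the right.\<close>
    have "\<alpha> \<le> F v" if "\<tau> < v" for v
    proof -
      have "Inf ?A < v"
        using le that by simp
      then obtain u where "\<alpha> \<le> F u" "u < v"
        using cInf_lessD[OF ne] by auto
      then show ?thesis
        using mono[of u v] by linarith
    qed
    then have "\<forall>\<^sub>F v in at_right \<tau>. \<alpha> \<le> F v"
      by (auto simp: eventually_at_filter)
    moreover have "(F \<longlongrightarrow> F \<tau>) (at_right \<tau>)"
      using D.cdf_is_right_cont[of \<tau>] unfolding F_def continuous_within .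
    ultimately show "\<alpha> \<le> F \<tau>"
      by (intro tendsto_lowerbound) auto
  qed
  then show ?thesis
    by (simp add: VaR_def F)
qed

text \<open>A reverse Fatou argument: along a convergent sequence of decisions, the event that
  \<open>L (z k) \<omega> \<le> \<tau>\<close> happens infinitely often still has probability at
  least \<open>\<alpha>\<close>.\<close>

lemma closed_probability_ge:
  fixes L :: "'b::first_countable_topology \<Rightarrow> 'a \<Rightarrow> real"
  assumes "prob_space M"
    and meas: "\<And>z. L z \<in> borel_measurable M"
    and cont: "\<And>\<omega>. \<omega> \<in> space M \<Longrightarrow> continuous_on UNIV (\<lambda>z. L z \<omega>)"
  shows "closed {z. \<alpha> \<le> measure M {\<omega> \<in> space M. L z \<omega> \<le> \<tau>}}"
  unfolding closed_sequential_limits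
proof (intro allI impI, elim conjE)
  interpret prob_space M by fact
  fix z l
  assume z: "\<forall>k. z k \<in> {z. \<alpha> \<le> prob {\<omega> \<in> space M. L z \<omega> \<le> \<tau>}}" and lim: "z \<longlonglongrightarrow> l"
  let ?E = "\<lambda>k. {\<omega> \<in> space M. L (z k) \<omega> \<le> \<tau>}"
  \<comment> \<open>These tail unions decrease to the limes superior of the events, so continuity
    from above applies even though the events themselves need not converge.\<close>
  define B where "B k = (\<Union>m\<in>{k..}. ?E m)" for k
  have E: "?E k \<in> events" for k
    using meas by measurable
  then have B: "B k \<in> events" for k
    unfolding B_def by blast
  have "\<alpha> \<le> prob (B k)" for k
  proof -
    have "\<alpha> \<le> prob (?E k)"
      using z by auto
    also have "\<dots> \<le> prob (B k)"
      using B by (intro finite_measure_mono) (auto simp: B_def)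
    finally show ?thesis .
  qed
  moreover have "(\<lambda>k. prob (B k)) \<longlonglongrightarrow> prob (\<Inter>k. B k)"
    using B by (intro finite_Lim_measure_decseq) (auto simp: decseq_def B_def intro: order_trans)
  ultimately have "\<alpha> \<le> prob (\<Inter>k. B k)"
    by (intro LIMSEQ_le_const) auto
  also have "\<dots> \<le> prob {\<omega> \<in> space M. L l \<omega> \<le> \<tau>}"
  proof (rule finite_measure_mono)
    show "{\<omega> \<in> space M. L l \<omega> \<le> \<tau>} \<in> events"
      using meas by measurable
    show "(\<Inter>k. B k) \<subseteq> {\<omega> \<in> space M. L l \<omega> \<le> \<tau>}"
    proof
      fix \<omega> assume "\<omega> \<in> (\<Inter>k. B k)"
      then have \<omega>: "\<omega> \<in> space M" and often: "\<And>k. \<exists>m\<ge>k. L (z m) \<omega> \<le> \<tau>"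
        by (auto simp: B_def)
      have lim': "(\<lambda>k. L (z k) \<omega>) \<longlonglongrightarrow> L l \<omega>"
        using cont[OF \<omega>] lim by (rule continuous_on_tendsto_compose) auto
      have "L l \<omega> \<le> \<tau>"
      proof (rule ccontr)
        assume "\<not> L l \<omega> \<le> \<tau>"
        then have "\<forall>\<^sub>F k in sequentially. \<tau> < L (z k) \<omega>"
          using order_tendstoD(1)[OF lim'] by simp
        then show False
          using often by (force simp: eventually_sequentially)
      qed
      with \<omega> show "\<omega> \<in> {\<omega> \<in> space M. L l \<omega> \<le> \<tau>}"
        by simp
    qed
  qed
  finally show "l \<in> {z. \<alpha> \<le> prob {\<omega> \<in> space M. L z \<omega> \<le> \<tau>}}"
    by simp
qed

lemma closed_VaR_le:
  fixes Y :: "'a \<Rightarrow> real ^ 'n"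
  assumes "prob_space M" and [measurable]: "Y \<in> borel_measurable M" and "0 < \<alpha>" and "\<alpha> < 1"
  shows "closed {z. VaR M \<alpha> (\<lambda>\<omega>. - (Y \<omega> \<bullet> z)) \<le> \<tau>}"
  using assms
  by (subst VaR_le_iff) (auto intro!: closed_probability_ge continuous_intros)

lemma compactin_feasible_set:
  assumes "prob_space M" and "\<And>t. t \<in> {1..T} \<Longrightarrow> \<xi> t \<in> borel_measurable M"
    and "0 < \<alpha>" and "\<alpha> < 1"
  shows "compactin (block_topology T) (feasible_set M \<xi> T \<alpha> \<tau>)"
proof -
  \<comment> \<open>Each constraint involves a single block, so the feasible set splits into a
    product and compactness can be checked factor by factor.\<close>
  have "feasible_set M \<xi> T \<alpha> \<tau> =
      (\<Pi>\<^sub>E t\<in>{1..T}. unit_simplex \<inter> {z. VaR M \<alpha> (\<lambda>\<omega>. - (\<xi> t \<omega> \<bullet> z)) \<le> \<tau>})"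
    unfolding feasible_set_def portfolio_paths_def PiE_iff set_eq_iff by blast
  then show ?thesis
    using assms
    by (auto simp: block_topology_def compactin_PiE
        intro!: compact_Int_closed compact_unit_simplex closed_VaR_le)
qed

text \<open>Block projections are continuous for indices in \<open>{1..T}\<close>. The turnover
  terms read block 1, which is in range by \<open>T \<ge> 1\<close>, and blocks \<open>t - 1\<close>
  with \<open>t \<ge> 2\<close>.\<close>

lemma continuous_map_objective:
  assumes "T \<ge> 1"
  shows "continuous_map (block_topology T) euclideanreal (objective T \<mu> lam1 lam2 c w_prev)"
proof -
  have block: "continuous_map (block_topology T) euclidean (\<lambda>x. x t)" if "t \<in> {1..T}" for t
    using that unfolding block_topology_def by (rule continuous_map_product_projection)
  have comp: "continuous_map (block_topology T) euclideanreal (\<lambda>x. g (x t))"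
    if "t \<in> {1..T}" "continuous_on UNIV g" for t and g :: "real ^ 'n \<Rightarrow> real"
    using continuous_map_compose[OF block[OF that(1)], of euclideanreal g] that(2)
    by (simp add: o_def)
  show ?thesis
    unfolding objective_def using assms
    by (intro continuous_map_add continuous_map_minus continuous_map_real_mult
        continuous_map_sum continuous_map_real_abs continuous_map_diff continuous_map_const[THEN iffD2]
        comp continuous_intros) auto
qed

text \<open>Once the minimum is attained at some \<open>x\<close>, the minimizers are the part of
  \<open>\<Omega>\<close> in the closed sublevel set at height \<open>f x\<close>.\<close>

lemma compact_solution_set:
  assumes comp: "compactin X \<Omega>" and cont: "continuous_map X euclideanreal f" and ne: "\<Omega> \<noteq> {}"
  shows "solution_set f \<Omega> \<noteq> {}" "compactin X (solution_set f \<Omega>)"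
proof -
  have "compact (f ` \<Omega>)"
    using image_compactin[OF comp cont] by simp
  then obtain x where x: "x \<in> \<Omega>" "\<And>y. y \<in> \<Omega> \<Longrightarrow> f x \<le> f y"
    using compact_attains_inf[of "f ` \<Omega>"] ne by auto
  then show "solution_set f \<Omega> \<noteq> {}"
    by (force simp: solution_set_def is_arg_min_def)
  have "closedin X {y \<in> topspace X. f y \<in> {..f x}}"
    using cont by (rule closedin_continuous_map_preimage) simp
  from closed_Int_compactin[OF this comp]
  have "compactin X ({y \<in> topspace X. f y \<in> {..f x}} \<inter> \<Omega>)" .
  moreover have "solution_set f \<Omega> = {y \<in> topspace X. f y \<in> {..f x}} \<inter> \<Omega>"
    using x compactin_subset_topspace[OF comp]
    by (force simp: solution_set_def is_arg_min_def not_less intro: order_trans)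
  ultimately show "compactin X (solution_set f \<Omega>)"
    by simp
qed

theorem theorem3p1:
  fixes M :: "'a measure"
    and \<xi> :: "nat \<Rightarrow> 'a \<Rightarrow> real ^ 'n"
    and \<xi>v :: "nat \<Rightarrow> nat \<Rightarrow> real ^ 'n"
    and p :: "nat \<Rightarrow> nat \<Rightarrow> real"
    and S :: "nat \<Rightarrow> nat"
    and T :: nat
    and w_prev :: "real ^ 'n"
    and c :: "'n \<Rightarrow> real"
    and \<alpha> lam1 lam2 \<tau> :: real
  defines "f \<equiv> objective T (\<lambda>t. scenario_mean (S t) (\<xi>v t) (p t)) lam1 lam2 c w_prev"
    and "\<Omega> \<equiv> feasible_set M \<xi> T \<alpha> \<tau>"
  assumes "prob_space M"
    and "T \<ge> 1"
    and "w_prev \<in> unit_simplex"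
    and "\<And>t. t \<in> {1..T} \<Longrightarrow> S t \<ge> 1"
    and "\<And>t. t \<in> {1..T} \<Longrightarrow> discrete_random_vector M (\<xi> t) (S t) (\<xi>v t) (p t)"
    and "0 < \<alpha>" and "\<alpha> < 1"
    and "lam1 > 0" and "lam2 > 0"
    and "\<And>i. c i \<ge> 0"
    and "\<Omega> \<noteq> {}"
  shows "(\<exists>x\<in>\<Omega>. \<forall>y\<in>\<Omega>. f x \<le> f y)
    \<and> \<bar>optimal_value f \<Omega>\<bar> \<noteq> \<infinity>
    \<and> solution_set f \<Omega> \<noteq> {}
    \<and> compactin (block_topology T) (solution_set f \<Omega>)"
proof -
  have "compactin (block_topology T) \<Omega>"
    unfolding \<Omega>_def using assms
    by (intro compactin_feasible_set) (auto simp: discrete_random_vector_def)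
  moreover have "continuous_map (block_topology T) euclideanreal f"
    unfolding f_def using \<open>T \<ge> 1\<close> by (rule continuous_map_objective)
  ultimately have sol: "solution_set f \<Omega> \<noteq> {}" "compactin (block_topology T) (solution_set f \<Omega>)"
    using compact_solution_set \<open>\<Omega> \<noteq> {}\<close> by blast+
  then obtain x where x: "x \<in> \<Omega>" "\<And>y. y \<in> \<Omega> \<Longrightarrow> f x \<le> f y"
    by (force simp: solution_set_def is_arg_min_def not_less)
  \<comment> \<open>The infimum is attained, hence it is the embedding of a real number and
    therefore finite.\<close>
  then have "optimal_value f \<Omega> = ereal (f x)"
    unfolding optimal_value_def by (intro INF_eqI) auto
  with x sol show ?thesis
    by auto
qed

end
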